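(* For every integer $m\ge 1$, the $3\times m$ grid is perfect for the star-game with Minimizer responding (and Maximizer initiating).
   Context: Graphs are finite, simple and undirected. $P_3$ is the path on three vertices; copies of $P_3$ in a graph are subgraphs, not necessarily induced. The $3\times m$ grid (three-row grid) is the Cartesian product of the path on $3$ vertices and the path on $m$ vertices ($3$ rows and $m$ columns, with vertices adjacent when they are horizontally or vertically consecutive). The star-game on a graph $G$ is played by two players, Maximizer and Minimizer; throughout the game one of them is the initiator and the other is the responder. In each round, the initiator chooses a vertex $v$ of the current graph such that the current graph contains at least one copy of $P_3$ with $v$ as its center vertex (degree-2 vertex of the path); the responder then chooses one copy of $P_3$ in the current graph with $v$ as its center; the three vertices of that copy are removed, and the next round is played on the subgraph induced by the remaining vertices. The game ends when the remaining graph contains no copy of $P_3$. Maximizer tries to maximize, and Minimizer tries to minimize, the number of copies of $P_3$ taken. The value of the game is the number of copies taken under optimal play by both players. A graph is perfect (for a given version of the game) if under optimal play all vertices are taken, i.e. the value of the game equals $|V(G)|/3$. *)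

theory Defs
  imports Complex_Main
begin

record 'a graph =
  verts :: "'a set"
  edges :: "'a set set"

definition simple_graph :: "'a graph \<Rightarrow> bool" where
  "simple_graph G \<longleftrightarrow> finite (verts G) \<and> (\<forall>e\<in>edges G. e \<subseteq> verts G \<and> card e = 2)"

definition induced :: "'a graph \<Rightarrow> 'a set \<Rightarrow> 'a graph" where
  "induced G S = \<lparr>verts = verts G \<inter> S, edges = {e \<in> edges G. e \<subseteq> S}\<rparr>"

definition path_graph :: "nat \<Rightarrow> nat graph" where
  "path_graph n = \<lparr>verts = {..<n}, edges = {{i, Suc i} | i. Suc i < n}\<rparr>"

definition cartesian_product :: "'a graph \<Rightarrow> 'b graph \<Rightarrow> ('a \<times> 'b) graph" where
  "cartesian_product G H =
     \<lparr>verts = verts G \<times> verts H,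
      edges = {{(x, u), (x, v)} | x u v. x \<in> verts G \<and> {u, v} \<in> edges H}
            \<union> {{(x, u), (y, u)} | x y u. {x, y} \<in> edges G \<and> u \<in> verts H}\<rparr>"

definition grid :: "nat \<Rightarrow> nat \<Rightarrow> (nat \<times> nat) graph" where
  "grid n m = cartesian_product (path_graph n) (path_graph m)"

text \<open>
  A copy of the three-vertex path is a subgraph, so it is recorded with its two edges;
  its end vertices may be adjacent in the host graph.
\<close>

definition P3_copies :: "'a graph \<Rightarrow> 'a \<Rightarrow> 'a graph set" where
  "P3_copies G v =
     {\<lparr>verts = {u, v, w}, edges = {{u, v}, {v, w}}\<rparr> | u w.
        {u, v, w} \<subseteq> verts G \<and> distinct [u, v, w] \<and> {u, v} \<in> edges G \<and> {v, w} \<in> edges G}"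

definition P3_centers :: "'a graph \<Rightarrow> 'a set" where
  "P3_centers G = {v \<in> verts G. P3_copies G v \<noteq> {}}"

definition remove_copy :: "'a graph \<Rightarrow> 'a graph \<Rightarrow> 'a graph" where
  "remove_copy G C = induced G (verts G - verts C)"

datatype player = Maximizer | Minimizer

fun opponent :: "player \<Rightarrow> player" where
  "opponent Maximizer = Minimizer"
| "opponent Minimizer = Maximizer"

fun best :: "player \<Rightarrow> nat set \<Rightarrow> nat" where
  "best Maximizer A = Max A"
| "best Minimizer A = Min A"

text \<open>
  The value of the game under optimal play, by backward induction.  The first argument is
  the initiator; the responder is the opponent.  The finiteness test only makes the
  recursion total: it holds for every simple graph, and then all sets passed to
  \<^const>\<open>best\<close> are finite and nonempty.
\<close>

function star_value :: "player \<Rightarrow> 'a graph \<Rightarrow> nat" where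
  "star_value p G =
     (if finite (verts G) \<and> P3_centers G \<noteq> {}
      then best p ((\<lambda>v. best (opponent p)
             ((\<lambda>C. 1 + star_value p (remove_copy G C)) ` P3_copies G v)) ` P3_centers G)
      else 0)"
  by pat_completeness auto
termination
proof (relation "Wellfounded.measure (\<lambda>(p, G). card (verts G))")
  fix p :: player and G C :: "'a graph" and v
  assume "finite (verts G) \<and> P3_centers G \<noteq> {}" "v \<in> P3_centers G" "C \<in> P3_copies G v"
  then have "verts G \<inter> (verts G - verts C) \<subset> verts G" "finite (verts G)"
    by (auto simp: P3_copies_def)
  then show "((p, remove_copy G C), (p, G)) \<in> Wellfounded.measure (\<lambda>(p, G). card (verts G))"
    by (simp add: remove_copy_def induced_def psubset_card_mono)
qed simp

declare star_value.simps [simp del]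

definition star_perfect :: "player \<Rightarrow> 'a graph \<Rightarrow> bool" where
  "star_perfect initiator G \<longleftrightarrow> real (star_value initiator G) = real (card (verts G)) / 3"

lemma simple_graph_path_graph: "simple_graph (path_graph n)"
  by (auto simp: simple_graph_def path_graph_def)

lemma simple_graph_cartesian_product:
  assumes "simple_graph G" "simple_graph H"
  shows "simple_graph (cartesian_product G H)"
proof -
  have "x \<in> verts G \<and> y \<in> verts G \<and> x \<noteq> y" if "{x, y} \<in> edges G" for x y
    using assms(1) that unfolding simple_graph_def by (cases "x = y") force+
  moreover have "u \<in> verts H \<and> v \<in> verts H \<and> u \<noteq> v" if "{u, v} \<in> edges H" for u v
    using assms(2) that unfolding simple_graph_def by (cases "u = v") force+
  ultimately show ?thesis
    using assms by (fastforce simp: simple_graph_def cartesian_product_def)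
qed

lemma simple_graph_grid: "simple_graph (grid n m)"
  unfolding grid_def by (intro simple_graph_cartesian_product simple_graph_path_graph)

lemma simple_graph_remove_copy: "simple_graph G \<Longrightarrow> simple_graph (remove_copy G C)"
  by (auto simp: simple_graph_def remove_copy_def induced_def)

lemma finite_P3_copies:
  assumes "finite (verts G)"
  shows "finite (P3_copies G v)"
proof (rule finite_subset)
  show "P3_copies G v \<subseteq>
      (\<lambda>(u, w). \<lparr>verts = {u, v, w}, edges = {{u, v}, {v, w}}\<rparr>) ` (verts G \<times> verts G)"
    by (auto simp: P3_copies_def)
qed (use assms in simp)

lemma finite_P3_centers: "finite (verts G) \<Longrightarrow> finite (P3_centers G)"
  by (simp add: P3_centers_def)

end

theory Submission
  imports Defs
begin

text \<open>
  Maximizer can take away the responder's choice: a center that has exactly two remaining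
  neighbours admits only one copy.  So it suffices to tile the vertices by copies of the
  three-vertex path and to order the tiles such that, when the turn of a tile comes, its center
  has no remaining neighbours outside the tile (\<open>clearable_schedule\<close>).  Every vertex is then
  taken, and no play can do better, since each round removes three vertices.

  For an even number of columns such an ordered tiling exists.  In each pair of consecutive
  columns, cut the $3 \times 2$ block into two corner-shaped tiles, one centered at the upper left
  corner of the block and one at the lower right corner.  First the upper tiles are taken from
  left to right: a center in the top row has lost its left neighbour by then.  Then the lower
  tiles are taken from right to left, for the same reason (\<open>clearable_corner_tiles\<close>).

  For an odd number of columns, Maximizer starts with the middle vertex of the last column and
  leaves Minimizer a real choice once.  If Minimizer takes the last column, an even grid
  remains.  Otherwise Minimizer takes the middle vertex of the column before and one corner, say
  the upper one; this is the picture for five columns, where X marks a remaining vertex: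

  \<^verbatim>\<open>    X X X X .\<close>

  \<^verbatim>\<open>    X X X . .\<close>

  \<^verbatim>\<open>    X X X X X\<close>

  The bottom vertex of the next-to-last column now has just its two horizontal neighbours left,
  so the last three vertices of the bottom row are a forced tile.  What remains is the
  even grid on all columns but the last, without its last lower tile.  The same order of
  corner tiles clears it.
\<close>

section \<open>Clearing a set of vertices\<close>

lemma P3_copy_removal:
  assumes "finite (verts G)" and "C \<in> P3_copies G v"
  shows "card (verts (remove_copy G C)) + 3 = card (verts G)"
proof -
  obtain u w where C: "verts C = {u, v, w}" "{u, v, w} \<subseteq> verts G" "distinct [u, v, w]"
    using assms(2) by (auto simp: P3_copies_def)
  have "verts (remove_copy G C) = verts G - {u, v, w}"
    using C(1) by (auto simp: remove_copy_def induced_def)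
  moreover have "card {u, v, w} = 3"
    using C(3) by simp
  ultimately show ?thesis
    using C(2) assms(1) card_mono[of "verts G" "{u, v, w}"] by (simp add: card_Diff_subset)
qed

lemma best_in: "finite A \<Longrightarrow> A \<noteq> {} \<Longrightarrow> best p A \<in> A"
  by (cases p) auto

text \<open>
  The bound does not depend on who initiates.  For Maximizer it is needed because the value is a
  maximum over all centers: one good center gives only a lower bound.
\<close>

lemma star_value_le:
  assumes "finite (verts G)"
  shows "3 * star_value p G \<le> card (verts G)"
  using assms
proof (induction p G rule: star_value.induct)
  case (1 p G)
  show ?case
  proof (cases "P3_centers G = {}")
    case True
    then show ?thesis by (simp add: star_value.simps)
  next
    case False
    define f where "f v = best (opponent p)
      ((\<lambda>C. 1 + star_value p (remove_copy G C)) ` P3_copies G v)" for v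
    have value_best: "star_value p G = best p (f ` P3_centers G)"
      using False 1(2) by (subst star_value.simps) (simp add: f_def)
    have "best p (f ` P3_centers G) \<in> f ` P3_centers G"
      using False 1(2) by (intro best_in) (auto simp: finite_P3_centers)
    then obtain v where v: "v \<in> P3_centers G" "star_value p G = f v"
      using value_best by auto
    have "f v \<in> (\<lambda>C. 1 + star_value p (remove_copy G C)) ` P3_copies G v"
      unfolding f_def using v(1) 1(2) by (intro best_in) (auto simp: finite_P3_copies P3_centers_def)
    then obtain C where C: "C \<in> P3_copies G v" "f v = 1 + star_value p (remove_copy G C)"
      by auto
    have "finite (verts (remove_copy G C))"
      using 1(2) by (simp add: remove_copy_def induced_def)
    then have "3 * star_value p (remove_copy G C) \<le> card (verts (remove_copy G C))"
      using 1(1)[OF _ v(1) C(1)] 1(2) False by simp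
    then show ?thesis
      using P3_copy_removal[OF 1(2) C(1)] v(2) C(2) by simp
  qed
qed

text \<open>
  Maximizer, as initiator, can force all of \<open>S\<close> to be taken in the subgraph induced on \<open>S\<close>.  The
  current position is kept as a vertex set of one host graph, so that only sets change
  during play.  The copy through \<open>u\<close> and \<open>w\<close> witnesses that \<open>v\<close> is a legal center; \<open>x\<close> and \<open>y\<close>
  range over the possible replies.
\<close>

inductive clearable :: "'a graph \<Rightarrow> 'a set \<Rightarrow> bool" for G where
  empty: "clearable G {}"
| move: "clearable G S"
  if "{u, v, w} \<subseteq> S" "distinct [u, v, w]" "{u, v} \<in> edges G" "{v, w} \<in> edges G"
    and "\<And>x y. {x, y} \<subseteq> S \<Longrightarrow> distinct [x, v, y] \<Longrightarrow> {x, v} \<in> edges G \<Longrightarrow> {v, y} \<in> edges G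
           \<Longrightarrow> clearable G (S - {x, v, y})"

lemma induced_verts: "simple_graph G \<Longrightarrow> induced G (verts G) = G"
  by (cases G) (auto simp: induced_def simple_graph_def)

text \<open>
  After the initiator's center in a clearing strategy, every reply leads to the same value by
  induction, so the minimum over the replies is a third of the number of vertices; the upper
  bound \<open>star_value_le\<close> makes this center optimal.
\<close>

lemma star_value_clearable:
  assumes "clearable G S" and "simple_graph G" and "S \<subseteq> verts G"
  shows "3 * star_value Maximizer (induced G S) = card S"
  using assms
proof (induction rule: clearable.induct)
  case empty
  then show ?case
    by (simp add: star_value.simps P3_centers_def induced_def)
next
  case (move u v w S)
  let ?H = "induced G S"
  have fin: "finite (verts ?H)"
    using move.prems by (simp add: induced_def simple_graph_def)
  have card: "card (verts ?H) = card S"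
    using move.prems by (simp add: induced_def Int_absorb1)
  have copy: "3 * (1 + star_value Maximizer (remove_copy ?H C)) = card S"
    if "C \<in> P3_copies ?H v" for C
  proof -
    have "\<exists>x y. verts C = {x, v, y} \<and> {x, y} \<subseteq> S \<and> distinct [x, v, y]
        \<and> {x, v} \<in> edges G \<and> {v, y} \<in> edges G"
      using that unfolding P3_copies_def induced_def by fastforce
    then obtain x y where xy: "verts C = {x, v, y}" "{x, y} \<subseteq> S" "distinct [x, v, y]"
      "{x, v} \<in> edges G" "{v, y} \<in> edges G"
      by blast
    have "remove_copy ?H C = induced G (S - {x, v, y})"
      using xy(1) move.prems by (auto simp: remove_copy_def induced_def simple_graph_def)
    moreover have "verts (induced G (S - {x, v, y})) = S - {x, v, y}"
      using move.prems by (auto simp: induced_def)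
    moreover have "3 * star_value Maximizer (induced G (S - {x, v, y})) = card (S - {x, v, y})"
      using move.IH[OF xy(2-5)] move.prems by auto
    ultimately show ?thesis
      using P3_copy_removal[OF fin that] card by simp
  qed
  define f where "f z = Min ((\<lambda>C. 1 + star_value Maximizer (remove_copy ?H C)) ` P3_copies ?H z)"
    for z
  have "\<lparr>verts = {u, v, w}, edges = {{u, v}, {v, w}}\<rparr> \<in> P3_copies ?H v"
    unfolding P3_copies_def induced_def mem_Collect_eq
    by (rule exI[of _ u], rule exI[of _ w]) (use move.hyps move.prems in auto)
  then have nonempty: "P3_copies ?H v \<noteq> {}" and v: "v \<in> P3_centers ?H"
    using move.hyps move.prems by (auto simp: P3_centers_def induced_def)
  have "f v \<in> (\<lambda>C. 1 + star_value Maximizer (remove_copy ?H C)) ` P3_copies ?H v"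
    unfolding f_def using nonempty fin by (intro Min_in) (auto simp: finite_P3_copies)
  then have "3 * f v = card S"
    using copy by auto
  moreover have "star_value Maximizer ?H = Max (f ` P3_centers ?H)"
    using fin v by (subst star_value.simps) (auto simp: f_def)
  then have "f v \<le> star_value Maximizer ?H"
    using fin v by (simp add: finite_P3_centers)
  ultimately show ?case
    using star_value_le[OF fin, of Maximizer] card by linarith
qed

lemma clearable_forced:
  assumes "distinct [u, v, w]" "{u, v, w} \<subseteq> S" "{u, v} \<in> edges G" "{v, w} \<in> edges G"
    and "\<And>x. x \<in> S \<Longrightarrow> {x, v} \<in> edges G \<Longrightarrow> x \<in> {u, w}"
    and "clearable G (S - {u, v, w})"
  shows "clearable G S"
proof (rule clearable.move)
  fix x y
  assume xy: "{x, y} \<subseteq> S" "distinct [x, v, y]" "{x, v} \<in> edges G" "{v, y} \<in> edges G"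
  then have "x \<in> {u, w}" "y \<in> {u, w}"
    using assms(5) by (auto simp: insert_commute)
  then have "{x, v, y} = {u, v, w}"
    using xy(2) by auto
  then show "clearable G (S - {x, v, y})"
    using assms(6) by simp
qed (use assms in auto)

text \<open>
  The tiles are the level sets of \<open>\<rho>\<close>, which also gives the order in which they are taken.  When
  the tile of least rank is reached, all other remaining vertices have a larger rank, so
  the center sees only the two ends of its tile and the move is forced.
\<close>

lemma clearable_schedule:
  fixes \<rho> :: "'a \<Rightarrow> nat"
  assumes "finite S"
    and "\<And>z. z \<in> S \<Longrightarrow> \<exists>u v w. {x \<in> S. \<rho> x = \<rho> z} = {u, v, w} \<and> distinct [u, v, w]
           \<and> {u, v} \<in> edges G \<and> {v, w} \<in> edges G
           \<and> (\<forall>x\<in>S. \<rho> z < \<rho> x \<longrightarrow> {x, v} \<notin> edges G)"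
    and "\<And>e. e \<in> edges G \<Longrightarrow> card e = 2"
  shows "clearable G S"
  using assms(1,2)
proof (induction S rule: finite_psubset_induct)
  case (psubset S)
  show ?case
  proof (cases "S = {}")
    case True
    then show ?thesis by (simp add: clearable.empty)
  next
    case False
    obtain z where z: "z \<in> S" and least: "\<And>x. x \<in> S \<Longrightarrow> \<rho> z \<le> \<rho> x"
      using arg_min_if_finite(1)[OF psubset.hyps(1) False, of \<rho>]
        arg_min_least[OF psubset.hyps(1) False, of _ \<rho>] by blast
    obtain u v w where tile: "{x \<in> S. \<rho> x = \<rho> z} = {u, v, w}" and P3: "distinct [u, v, w]"
      "{u, v} \<in> edges G" "{v, w} \<in> edges G"
      and later: "\<And>x. x \<in> S \<Longrightarrow> \<rho> z < \<rho> x \<Longrightarrow> {x, v} \<notin> edges G"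
      using psubset.prems[OF z] by blast
    have in_S: "{u, v, w} \<subseteq> S"
      using tile by blast
    have "clearable G (S - {u, v, w})"
    proof (rule psubset.IH)
      show "S - {u, v, w} \<subset> S"
        using in_S by blast
    next
      fix z' assume z': "z' \<in> S - {u, v, w}"
      then have "\<rho> z' \<noteq> \<rho> z"
        using tile by blast
      moreover have "\<rho> x = \<rho> z" if "x \<in> {u, v, w}" for x
        using that tile by blast
      ultimately have "{x \<in> S - {u, v, w}. \<rho> x = \<rho> z'} = {x \<in> S. \<rho> x = \<rho> z'}"
        by (intro Collect_cong) auto
      then show "\<exists>u' v' w'. {x \<in> S - {u, v, w}. \<rho> x = \<rho> z'} = {u', v', w'} \<and> distinct [u', v', w']
           \<and> {u', v'} \<in> edges G \<and> {v', w'} \<in> edges G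
           \<and> (\<forall>x\<in>S - {u, v, w}. \<rho> z' < \<rho> x \<longrightarrow> {x, v'} \<notin> edges G)"
        using psubset.prems[of z'] z' by simp (metis (no_types, lifting) Diff_iff)
    qed
    moreover have "x \<in> {u, w}" if "x \<in> S" "{x, v} \<in> edges G" for x
    proof -
      have "\<rho> x = \<rho> z"
        using later[OF that(1)] least[OF that(1)] that(2) by linarith
      moreover have "x \<noteq> v"
        using assms(3)[OF that(2)] by auto
      ultimately show ?thesis
        using tile that(1) by blast
    qed
    ultimately show ?thesis
      using clearable_forced[OF P3(1) in_S P3(2,3)] by blast
  qed
qed

section \<open>Adjacency in grids\<close>

lemma verts_grid: "verts (grid n m) = {..<n} \<times> {..<m}"
  by (simp add: grid_def cartesian_product_def path_graph_def)

lemma edges_path_graph: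
  "{i, j} \<in> edges (path_graph n) \<longleftrightarrow> i < n \<and> j < n \<and> (j = Suc i \<or> i = Suc j)"
  by (auto simp: path_graph_def doubleton_eq_iff)

lemma edges_cartesian_product:
  "{(x, u), (y, v)} \<in> edges (cartesian_product G H) \<longleftrightarrow>
     x = y \<and> x \<in> verts G \<and> {u, v} \<in> edges H \<or> u = v \<and> u \<in> verts H \<and> {x, y} \<in> edges G"
    (is "?L \<longleftrightarrow> ?R")
proof
  show "?L \<Longrightarrow> ?R"
    unfolding cartesian_product_def by (auto simp: doubleton_eq_iff insert_commute)
  show "?R \<Longrightarrow> ?L"
    unfolding cartesian_product_def by auto
qed

lemma edges_grid:
  "{(r, c), (r', c')} \<in> edges (grid n m) \<longleftrightarrow>
     r < n \<and> r' < n \<and> c < m \<and> c' < m \<and>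
     (r = r' \<and> (c' = Suc c \<or> c = Suc c') \<or> c = c' \<and> (r' = Suc r \<or> r = Suc r'))"
  unfolding grid_def edges_cartesian_product edges_path_graph by (auto simp: path_graph_def)

lemma card_edge_grid: "e \<in> edges (grid n m) \<Longrightarrow> card e = 2"
  using simple_graph_grid by (simp add: simple_graph_def)

section \<open>Clearing the three-row grid\<close>

text \<open>
  The first set is the union of \<open>k\<close> corner tiles centered in the outer row \<open>t\<close>, the second
  that of \<open>l\<close> corner tiles centered in the opposite row; both start at the left border.  For an
  odd number of columns the two corners that Minimizer may take correspond to \<open>t = 0\<close> and
  \<open>t = 2\<close>, and both leave \<open>l = k - 1\<close>.
\<close>

definition corner_tiles :: "nat \<Rightarrow> nat \<Rightarrow> nat \<Rightarrow> (nat \<times> nat) set" where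
  "corner_tiles t k l =
     {(r, c). r = t \<and> c < 2 * k \<or> r = 1 \<and> even c \<and> c < 2 * k}
   \<union> {(r, c). r = 2 - t \<and> c < 2 * l \<or> r = 1 \<and> odd c \<and> c < 2 * l}"

text \<open>
  In row \<open>t\<close> the center \<open>2 * j\<close> has lost its left neighbour to the tile \<open>j - 1\<close>.  In row \<open>2 - t\<close>
  the center \<open>2 * j + 1\<close> has lost its right neighbour to the tile \<open>j + 1\<close>.  The middle-row neighbour
  of a center belongs to the same tile.
\<close>

lemma clearable_corner_tiles:
  assumes t: "t \<in> {0, 2}" and m: "2 * k \<le> m" "2 * l \<le> m"
  shows "clearable (grid 3 m) (corner_tiles t k l)"
proof (rule clearable_schedule)
  show "finite (corner_tiles t k l)"
    by (rule finite_subset[of _ "{..<3} \<times> {..<m}"]) (use t m in \<open>auto simp: corner_tiles_def\<close>)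
next
  \<comment> \<open>Both tiles in columns \<open>2 * j\<close> and \<open>2 * j + 1\<close> have \<open>c div 2 = j\<close>.  Subtracting from
    \<open>2 * m\<close> reverses the order and puts all tiles centered in row \<open>2 - t\<close> after the others.\<close>
  let ?\<rho> = "\<lambda>(r, c). if r = t \<or> r = 1 \<and> even c then c div 2 else 2 * m - c div 2"
  fix z assume z: "z \<in> corner_tiles t k l"
  obtain r c where rc: "z = (r, c)"
    by (cases z)
  define j where "j = c div 2"
  show "\<exists>u v w. {x \<in> corner_tiles t k l. ?\<rho> x = ?\<rho> z} = {u, v, w} \<and> distinct [u, v, w]
           \<and> {u, v} \<in> edges (grid 3 m) \<and> {v, w} \<in> edges (grid 3 m)
           \<and> (\<forall>x\<in>corner_tiles t k l. ?\<rho> z < ?\<rho> x \<longrightarrow> {x, v} \<notin> edges (grid 3 m))"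
  proof (cases "r = t \<or> r = 1 \<and> even c")
    case True
    then have j: "j < k" "?\<rho> z = j"
      using z rc t by (auto simp: corner_tiles_def j_def)
    have tile: "{x \<in> corner_tiles t k l. ?\<rho> x = j} = {(t, 2 * j + 1), (t, 2 * j), (1, 2 * j)}"
      using j t m by (auto simp: corner_tiles_def split: if_splits)
    have later: "{x, (t, 2 * j)} \<notin> edges (grid 3 m)" if "x \<in> corner_tiles t k l" "j < ?\<rho> x" for x
    proof
      assume edge: "{x, (t, 2 * j)} \<in> edges (grid 3 m)"
      obtain r' c' where x: "x = (r', c')"
        by (cases x)
      have "r' = t \<and> (c' = 2 * j + 1 \<or> Suc c' = 2 * j) \<or> r' = 1 \<and> c' = 2 * j"
        using edge t by (auto simp: x edges_grid)
      then show False
        using that(2) t by (auto simp: x)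
    qed
    have "distinct [(t, 2 * j + 1), (t, 2 * j), (1, 2 * j)]"
      "{(t, 2 * j + 1), (t, 2 * j)} \<in> edges (grid 3 m)"
      "{(t, 2 * j), (1, 2 * j)} \<in> edges (grid 3 m)"
      using j t m by (auto simp: edges_grid)
    then show ?thesis
      unfolding j(2) using tile later by blast
  next
    case False
    then have j: "j < l" "?\<rho> z = 2 * m - j"
      using z rc t by (auto simp: corner_tiles_def j_def)
    have tile: "{x \<in> corner_tiles t k l. ?\<rho> x = 2 * m - j} =
        {(2 - t, 2 * j), (2 - t, 2 * j + 1), (1, 2 * j + 1)}"
    proof (rule set_eqI)
      fix x :: "nat \<times> nat"
      obtain r' c' where x: "x = (r', c')"
        by (cases x)
      have "x \<in> corner_tiles t k l \<and> ?\<rho> x = 2 * m - j \<longleftrightarrow>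
          c' div 2 = j \<and> (r' = 2 - t \<or> r' = 1 \<and> odd c')"
      proof -
        have "2 * m - c' div 2 = 2 * m - j \<longleftrightarrow> c' div 2 = j" if "c' < 2 * l"
          using that m j by linarith
        moreover have "c' div 2 \<noteq> 2 * m - j" if "c' < 2 * k"
          using that m j by linarith
        moreover have "c' < 2 * l" if "c' div 2 = j"
          using that j by linarith
        moreover have "2 - t \<noteq> t" "2 - t \<noteq> 1" "t \<noteq> 1"
          using t by auto
        ultimately show ?thesis
          unfolding x corner_tiles_def by auto
      qed
      also have "\<dots> \<longleftrightarrow> x \<in> {(2 - t, 2 * j), (2 - t, 2 * j + 1), (1, 2 * j + 1)}"
      proof -
        have "c' div 2 = j \<longleftrightarrow> c' = 2 * j \<or> c' = 2 * j + 1"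
          by linarith
        moreover have "odd c' \<longleftrightarrow> c' = 2 * j + 1" if "c' div 2 = j"
          using that by presburger
        ultimately show ?thesis
          unfolding x by auto
      qed
      finally show "x \<in> {x \<in> corner_tiles t k l. ?\<rho> x = 2 * m - j} \<longleftrightarrow>
          x \<in> {(2 - t, 2 * j), (2 - t, 2 * j + 1), (1, 2 * j + 1)}"
        by simp
    qed
    have later: "{x, (2 - t, 2 * j + 1)} \<notin> edges (grid 3 m)"
      if "x \<in> corner_tiles t k l" "2 * m - j < ?\<rho> x" for x
    proof
      assume edge: "{x, (2 - t, 2 * j + 1)} \<in> edges (grid 3 m)"
      obtain r' c' where x: "x = (r', c')"
        by (cases x)
      have "r' = 2 - t \<and> (c' = 2 * j \<or> c' = 2 * j + 2) \<or> r' = 1 \<and> c' = 2 * j + 1"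
        using edge t by (auto simp: x edges_grid)
      then show False
        using that(2) t m j by (auto simp: x)
    qed
    have "distinct [(2 - t, 2 * j), (2 - t, 2 * j + 1), (1, 2 * j + 1)]"
      "{(2 - t, 2 * j), (2 - t, 2 * j + 1)} \<in> edges (grid 3 m)"
      "{(2 - t, 2 * j + 1), (1, 2 * j + 1)} \<in> edges (grid 3 m)"
      using j t m by (auto simp: edges_grid)
    then show ?thesis
      unfolding j(2) using tile later by blast
  qed
qed (rule card_edge_grid)

lemma clearable_even_block: "2 * k \<le> m \<Longrightarrow> clearable (grid 3 m) ({..<3} \<times> {..<2 * k})"
proof -
  assume "2 * k \<le> m"
  moreover have "corner_tiles 0 k k = {..<3} \<times> {..<2 * k}"
    by (auto simp: corner_tiles_def)
  ultimately show ?thesis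
    using clearable_corner_tiles[of 0 k m k] by simp
qed

text \<open>
  The position after the reply that bends into the grid.  In the row opposite to the
  lost corner, the next-to-last vertex has lost its middle-row neighbour, so the last three
  vertices of that row are a forced copy, and corner tiles remain.
\<close>

lemma clearable_last_column_corner:
  assumes t: "t \<in> {0, 2}" and "k \<ge> 1"
  shows "clearable (grid 3 (2 * k + 1))
     ({..<3} \<times> {..<2 * k + 1} - {(t, 2 * k), (1, 2 * k), (1, 2 * k - 1)})"
proof -
  obtain l where k: "k = Suc l"
    using assms(2) by (cases k) auto
  let ?G = "grid 3 (2 * k + 1)"
  let ?S = "{..<3} \<times> {..<2 * k + 1} - {(t, 2 * k), (1, 2 * k), (1, 2 * k - 1)}"
  let ?b = "2 - t"
  have rest: "?S - {(?b, 2 * k), (?b, 2 * k - 1), (?b, 2 * k - 2)} = corner_tiles t k l"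
  proof (rule set_eqI)
    fix x :: "nat \<times> nat"
    obtain r c where x: "x = (r, c)"
      by (cases x)
    have "c < 2 * k + 1 \<and> c \<noteq> 2 * k \<and> c \<noteq> 2 * k - 1 \<longleftrightarrow>
        even c \<and> c < 2 * k \<or> odd c \<and> c < 2 * l"
      unfolding k by presburger
    moreover have "c < 2 * k + 1 \<and> c \<noteq> 2 * k \<and> c \<noteq> 2 * k - 1 \<and> c \<noteq> 2 * k - 2 \<longleftrightarrow> c < 2 * l"
      "c < 2 * k + 1 \<and> c \<noteq> 2 * k \<longleftrightarrow> c < 2 * k"
      unfolding k by presburger+
    moreover have "r < 3 \<longleftrightarrow> r = t \<or> r = 1 \<or> r = ?b" "t \<noteq> 1" "?b \<noteq> 1" "?b \<noteq> t"
      using t by auto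
    ultimately show "x \<in> ?S - {(?b, 2 * k), (?b, 2 * k - 1), (?b, 2 * k - 2)}
        \<longleftrightarrow> x \<in> corner_tiles t k l"
      unfolding x corner_tiles_def mem_Collect_eq Un_iff Diff_iff mem_Sigma_iff lessThan_iff
        insert_iff empty_iff prod.inject case_prod_conv by blast
  qed
  show ?thesis
  proof (rule clearable_forced)
    show "distinct [(?b, 2 * k), (?b, 2 * k - 1), (?b, 2 * k - 2)]"
      "{(?b, 2 * k), (?b, 2 * k - 1), (?b, 2 * k - 2)} \<subseteq> ?S"
      "{(?b, 2 * k), (?b, 2 * k - 1)} \<in> edges ?G"
      "{(?b, 2 * k - 1), (?b, 2 * k - 2)} \<in> edges ?G"
      using t k by (auto simp: edges_grid)
    show "clearable ?G (?S - {(?b, 2 * k), (?b, 2 * k - 1), (?b, 2 * k - 2)})"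
      unfolding rest using t k by (intro clearable_corner_tiles) auto
    fix x
    assume x: "x \<in> ?S" "{x, (?b, 2 * k - 1)} \<in> edges ?G"
    obtain r c where rc: "x = (r, c)"
      by (cases x)
    have "r = ?b \<and> (c = 2 * k \<or> c = 2 * k - 2) \<or> r = 1 \<and> c = 2 * k - 1"
      using x(2) t k by (auto simp: rc edges_grid)
    then show "x \<in> {(?b, 2 * k), (?b, 2 * k - 2)}"
      using x(1) by (auto simp: rc)
  qed
qed

lemma clearable_odd_grid: "clearable (grid 3 (2 * k + 1)) ({..<3} \<times> {..<2 * k + 1})"
proof (rule clearable.move)
  let ?G = "grid 3 (2 * k + 1)"
  let ?S = "{..<3 :: nat} \<times> {..<2 * k + 1}"
  let ?v = "(1 :: nat, 2 * k)"
  show "{(0, 2 * k), ?v, (2, 2 * k)} \<subseteq> ?S" "distinct [(0, 2 * k), ?v, (2, 2 * k)]"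
    "{(0, 2 * k), ?v} \<in> edges ?G" "{?v, (2, 2 * k)} \<in> edges ?G"
    by (auto simp: edges_grid)
  fix x y
  assume xy: "{x, y} \<subseteq> ?S" "distinct [x, ?v, y]" "{x, ?v} \<in> edges ?G" "{?v, y} \<in> edges ?G"
  have nbr: "z \<in> {(0, 2 * k), (2, 2 * k)} \<or> z = (1, 2 * k - 1) \<and> k \<ge> 1"
    if "{z, ?v} \<in> edges ?G" for z
    using that by (cases z) (auto simp: edges_grid)
  have "{y, ?v} \<in> edges ?G"
    using xy(4) by (simp add: insert_commute)
  then consider "{x, ?v, y} = {(0, 2 * k), ?v, (2, 2 * k)}"
    | t where "t \<in> {0, 2}" "k \<ge> 1" "{x, ?v, y} = {(t, 2 * k), ?v, (1, 2 * k - 1)}"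
  proof (cases "x = (1, 2 * k - 1)")
    case True
    then have "y = (0, 2 * k) \<or> y = (2, 2 * k)" "k \<ge> 1"
      using nbr[OF xy(3)] nbr[of y] xy(2) \<open>{y, ?v} \<in> edges ?G\<close> by auto
    then show ?thesis
      using True that(2)[of "fst y"] by (auto simp: insert_commute)
  next
    case False
    then have x: "x = (0, 2 * k) \<or> x = (2, 2 * k)"
      using nbr[OF xy(3)] by auto
    show ?thesis
    proof (cases "y = (1, 2 * k - 1)")
      case True
      then have "k \<ge> 1"
        using nbr[of y] \<open>{y, ?v} \<in> edges ?G\<close> by auto
      then show ?thesis
        using True x that(2)[of "fst x"] by auto
    next
      case False
      then have "y = (0, 2 * k) \<or> y = (2, 2 * k)"
        using nbr[of y] \<open>{y, ?v} \<in> edges ?G\<close> by auto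
      then show ?thesis
        using x xy(2) that(1) by (auto simp: insert_commute)
    qed
  qed
  then show "clearable ?G (?S - {x, ?v, y})"
  proof cases
    case 1
    have "?S - {(0, 2 * k), ?v, (2, 2 * k)} = {..<3} \<times> {..<2 * k}"
      by auto
    then show ?thesis
      unfolding 1 using clearable_even_block[of k "2 * k + 1"] by simp
  next
    case 2
    then show ?thesis
      using clearable_last_column_corner by metis
  qed
qed

theorem lemma15:
  fixes m :: nat
  assumes "m \<ge> 1"
  shows "star_perfect Maximizer (grid 3 m)"
proof -
  have "clearable (grid 3 m) (verts (grid 3 m))"
  proof (cases "even m")
    case True
    then show ?thesis
      using clearable_even_block[of "m div 2" m] by (simp add: verts_grid)
  next
    case False
    then show ?thesis
      using clearable_odd_grid[of "m div 2"] by (simp add: verts_grid)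
  qed
  then have "3 * star_value Maximizer (induced (grid 3 m) (verts (grid 3 m)))
      = card (verts (grid 3 m))"
    by (rule star_value_clearable) (auto simp: simple_graph_grid)
  moreover have "induced (grid 3 m) (verts (grid 3 m)) = grid 3 m"
    using simple_graph_grid by (rule induced_verts)
  ultimately show ?thesis
    unfolding star_perfect_def by (simp flip: of_nat_mult)
qed

end
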